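(* (Singleton bound) Let $\mathcal I=(t,m,n,\mathcal X,\mathcal X^{(S)},R)$ be an instance of the ICCSI problem over $\mathbb F_q$ with $t>1$ and message space $\mathcal M\subset\mathbb F_q^{n\times t}$, and let $\delta\ge0$ be an integer. Then, for the rank metric, $$\mathcal N(\mathcal I,\delta)\ge\begin{cases}\dfrac{\alpha(\mathcal I)}{t}+2\delta&\text{if }t\ge N(t,\alpha(\mathcal I),2\delta+1),\\[2mm]\dfrac{\alpha(\mathcal I)}{t-2\delta}&\text{if }t\le N(t,\alpha(\mathcal I),2\delta+1).\end{cases}$$
   Context: Notation: $q$ is a prime power, $\mathbb F_q$ the field with $q$ elements, $[m]=\{1,\dots,m\}$. For a matrix $A$, $A_i$ is its $i$-th row and $\langle A\rangle$ its row space; $w(A)$ is the rank of $A$, and the rank distance between $A,B$ is the rank of $A-B$. Instance of the ICCSI (index coding with coded side information) problem: positive integers $t>1$, $m$, $n$; subspaces $\mathcal X^{(S)}$ and $\mathcal X^{(i)}$ ($i\in[m]$) of $\mathbb F_q^n$ of dimensions $d_S$ and $d_i$; $\mathcal X=\{A\in\mathbb F_q^{m\times n}:A_i\in\mathcal X^{(i)},\ i\in[m]\}$; a matrix $R\in\mathbb F_q^{m\times n}$ with rows $R_i\in\mathcal X^{(S)}\setminus\mathcal X^{(i)}$. Fix $V^{(S)}\in\mathbb F_q^{d_S\times n}$, $V^{(i)}\in\mathbb F_q^{d_i\times n}$ with $\langle V^{(S)}\rangle=\mathcal X^{(S)}$, $\langle V^{(i)}\rangle=\mathcal X^{(i)}$.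 Set $\mathcal Z_\delta^{(i)}=\{Z\in\mathbb F_q^{n\times t}:V^{(i)}Z=0,\ R_iZ\ne0,\ \operatorname{rank}(Z)\ge2\delta+1\}$. Message space: $\mathcal M\subset\mathbb F_q^{n\times t}$ has minimum rank distance at least $2\delta+1$, and $\{V^{(S)}X:X\in\mathcal M\}\subset\mathbb F_q^{d_S\times t}$ has minimum rank distance $2\delta+1$. Error-correcting index codes: $L\in\mathbb F_q^{N\times d_S}$ ($N$ a positive integer) represents an $\mathbb F_q$-linear rank metric $(\mathcal I,\delta)$-ECIC of length $N$ if for each $i\in[m]$ there is a map $D_i:\mathbb F_q^{N\times t}\times\mathbb F_q^{d_i\times t}\to\mathbb F_q^t$ with $D_i(LV^{(S)}X+W,V^{(i)}X)=R_iX$ for all $X\in\mathcal M$ and all $W\in\mathbb F_q^{N\times t}$ with $w(W)\le\delta$. $\mathcal N(\mathcal I,\delta)$ is the optimal (minimum) length $N$ of such a code. $N(t,\log_qM,d)$ is the least integer $s$ such that there exists a code (subset) in $\mathbb F_q^{s\times t}$ of minimum rank distance $d$ and size $M$. Let $\mathcal J(\mathcal I)$ be the collection of subsets $U\subset\mathbb F_q^{n\times t}$ such that $X-X'\in\bigcup_{i\in[m]}\mathcal Z_\delta^{(i)}$ for any distinct $X,X'\in U$, and $\alpha(\mathcal I)=\max\{\log_q|U|:U\in\mathcal J(\mathcal I),\ U\neq\emptyset\}$. It is understood that $\alpha(\mathcal I)>0$, so that $N(t,\alpha(\mathcal I),2\delta+1)$ is defined (a one-element code has no minimum distance).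
   Formalization: In the definition of J(I), each difference X−X' of distinct elements of U must also be a difference of two messages in M; without this the bound fails, e.g. δ=0, t=m=n=2, X^(S)=F_q^2, X^(i)=0, R=I, M={0,A}, rank A=1. *)

theory Defs
  imports Complex_Main "HOL-Library.Cardinality" "Jordan_Normal_Form.DL_Rank"
begin

text \<open>
  The field with q elements is a type of class \<open>field\<close> and \<open>finite\<close>, with \<open>q = CARD('a)\<close>. Rows and
  receivers are indexed from 0, so the index set is \<open>{..<m}\<close>.
\<close>

definition mat_rank :: "'a::field mat \<Rightarrow> nat" where
  "mat_rank A = vec_space.rank (dim_row A) A"

definition row_span :: "'a::field mat \<Rightarrow> 'a vec set" where
  "row_span A = vec_space.row_space (dim_col A) A"

definition vec_subspace :: "nat \<Rightarrow> 'a::field vec set \<Rightarrow> bool" where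
  "vec_subspace n W \<longleftrightarrow> VectorSpace.subspace class_ring W (module_vec TYPE('a) n)"

definition subspace_dim :: "nat \<Rightarrow> 'a::field vec set \<Rightarrow> nat" where
  "subspace_dim n W = vectorspace.dim class_ring ((module_vec TYPE('a) n)\<lparr>carrier := W\<rparr>)"

text \<open>A code with fewer than two elements has no minimum distance.\<close>

definition has_min_rank_dist :: "'a::field mat set \<Rightarrow> nat \<Rightarrow> bool" where
  "has_min_rank_dist C d \<longleftrightarrow>
     (\<exists>A\<in>C. \<exists>B\<in>C. A \<noteq> B \<and> mat_rank (A - B) = d) \<and>
     (\<forall>A\<in>C. \<forall>B\<in>C. A \<noteq> B \<longrightarrow> d \<le> mat_rank (A - B))"

text \<open>
  An instance of the ICCSI problem. The set of matrices whose \<open>i\<close>-th row lies in \<open>X i\<close> for each \<open>i\<close>,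
  which is part of the instance, is determined by the family \<open>X\<close>.
\<close>

definition iccsi_instance ::
  "nat \<Rightarrow> nat \<Rightarrow> nat \<Rightarrow> 'a::{field,finite} vec set \<Rightarrow> (nat \<Rightarrow> 'a vec set) \<Rightarrow> 'a mat \<Rightarrow> bool" where
  "iccsi_instance t m n XS X R \<longleftrightarrow>
     1 < t \<and> 0 < m \<and> 0 < n \<and>
     vec_subspace n XS \<and> (\<forall>i<m. vec_subspace n (X i)) \<and>
     R \<in> carrier_mat m n \<and> (\<forall>i<m. row R i \<in> XS - X i)"

definition spanning_matrix :: "nat \<Rightarrow> 'a::field vec set \<Rightarrow> 'a mat \<Rightarrow> bool" where
  "spanning_matrix n W V \<longleftrightarrow> V \<in> carrier_mat (subspace_dim n W) n \<and> row_span V = W"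

definition message_space :: "nat \<Rightarrow> nat \<Rightarrow> nat \<Rightarrow> 'a::field mat \<Rightarrow> 'a mat set \<Rightarrow> bool" where
  "message_space t n \<delta> VS M \<longleftrightarrow>
     M \<subseteq> carrier_mat n t \<and>
     (\<exists>d \<ge> 2 * \<delta> + 1. has_min_rank_dist M d) \<and>
     has_min_rank_dist ((\<lambda>Y. VS * Y) ` M) (2 * \<delta> + 1)"

text \<open>\<open>row (R * Y) i\<close> is the product of the \<open>i\<close>-th row of \<open>R\<close> with \<open>Y\<close>.\<close>

definition Z_set :: "nat \<Rightarrow> nat \<Rightarrow> 'a::field mat \<Rightarrow> nat \<Rightarrow> (nat \<Rightarrow> 'a mat) \<Rightarrow> nat \<Rightarrow> 'a mat set" where
  "Z_set t n R \<delta> V i =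
     {Z \<in> carrier_mat n t. V i * Z = 0\<^sub>m (dim_row (V i)) t \<and> row (R * Z) i \<noteq> 0\<^sub>v t \<and>
        2 * \<delta> + 1 \<le> mat_rank Z}"

definition represents_ECIC ::
  "nat \<Rightarrow> nat \<Rightarrow> 'a::field mat \<Rightarrow> 'a mat \<Rightarrow> (nat \<Rightarrow> 'a mat) \<Rightarrow> 'a mat set \<Rightarrow> nat \<Rightarrow> nat \<Rightarrow> 'a mat \<Rightarrow> bool"
where
  "represents_ECIC t m R VS V M \<delta> N L \<longleftrightarrow>
     0 < N \<and> L \<in> carrier_mat N (dim_row VS) \<and>
     (\<forall>i<m. \<exists>D :: 'a mat \<Rightarrow> 'a mat \<Rightarrow> 'a vec.
        \<forall>Y\<in>M. \<forall>W\<in>carrier_mat N t. mat_rank W \<le> \<delta> \<longrightarrow>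
          D (L * VS * Y + W) (V i * Y) = row (R * Y) i)"

definition optimal_length ::
  "nat \<Rightarrow> nat \<Rightarrow> 'a::field mat \<Rightarrow> 'a mat \<Rightarrow> (nat \<Rightarrow> 'a mat) \<Rightarrow> 'a mat set \<Rightarrow> nat \<Rightarrow> nat" where
  "optimal_length t m R VS V M \<delta> = (LEAST N. \<exists>L. represents_ECIC t m R VS V M \<delta> N L)"

definition shortest_code :: "'a::{field,finite} itself \<Rightarrow> nat \<Rightarrow> real \<Rightarrow> nat \<Rightarrow> nat" where
  "shortest_code T t a d =
     (LEAST s. \<exists>C :: 'a mat set. C \<subseteq> carrier_mat s t \<and> has_min_rank_dist C d \<and>
        log (real CARD('a)) (real (card C)) = a)"

text \<open>
  The elements of \<open>\<Union>i. Z_set t n R \<delta> V i\<close> stand for differences of two messages that some receiver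
  must tell apart. Since the decoders only have to be correct on \<open>M\<close>, an element of this union that
  is not a difference of two messages imposes no condition on a code; with such differences allowed
  below, the Singleton bound fails. For example, let \<open>\<delta> = 0\<close>, \<open>t = m = n = 2\<close>, \<open>X i = {0}\<close>, \<open>R = 1\<close> and
  \<open>M = {0, A}\<close> with \<open>A\<close> of rank 1: there is a code of length 1, while all of \<open>carrier_mat 2 2\<close> would be
  admitted and give the bound 2. The last conjunct excludes this. It holds for every \<open>U \<subseteq> M\<close>, and it
  is void if \<open>M = carrier_mat n t\<close>.
\<close>

definition J_sets ::
  "nat \<Rightarrow> nat \<Rightarrow> nat \<Rightarrow> 'a::field mat \<Rightarrow> (nat \<Rightarrow> 'a mat) \<Rightarrow> 'a mat set \<Rightarrow> nat \<Rightarrow> 'a mat set set" where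
  "J_sets t m n R V M \<delta> =
     {U. U \<subseteq> carrier_mat n t \<and>
        (\<forall>Y\<in>U. \<forall>Y'\<in>U. Y \<noteq> Y' \<longrightarrow>
           Y - Y' \<in> (\<Union>i<m. Z_set t n R \<delta> V i) \<and> (\<exists>A\<in>M. \<exists>B\<in>M. Y - Y' = A - B))}"

definition alpha ::
  "nat \<Rightarrow> nat \<Rightarrow> nat \<Rightarrow> 'a::{field,finite} mat \<Rightarrow> (nat \<Rightarrow> 'a mat) \<Rightarrow> 'a mat set \<Rightarrow> nat \<Rightarrow> real" where
  "alpha t m n R V M \<delta> =
     Max {log (real CARD('a)) (real (card U)) | U. U \<in> J_sets t m n R V M \<delta> \<and> U \<noteq> {}}"

end

theory Submission
  imports Defs
begin

text \<open>
  For a code of length \<open>N\<close> and a set \<open>U\<close> attaining \<open>alpha\<close>, the map \<open>Y \<mapsto> L V\<^sup>S Y\<close> turns \<open>U\<close> into a rank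
  metric code of the same size and distance at least \<open>2\<delta> + 1\<close>: otherwise the image of a difference
  would be a sum of two matrices of rank at most \<open>\<delta>\<close>, and some receiver could not tell apart two
  messages with that difference. Deleting \<open>2\<delta>\<close> rows, or \<open>2\<delta>\<close> columns, is injective on such a code, so
  \<open>\<alpha> \<le> t (N - 2\<delta>)\<close> and \<open>\<alpha> \<le> N (t - 2\<delta>)\<close>.
\<close>

section \<open>Rank and factorisations\<close>

text \<open>Columns of \<open>B * C\<close> are combinations of the \<open>k\<close> columns of
  \<open>B\<close>. With \<open>mat_rank_factorization\<close> this makes rank the least inner
  dimension of a factorisation, so a rank is bounded by exhibiting one.\<close>

lemma mat_rank_mult_le:
  assumes B: "B \<in> carrier_mat n k" and C: "C \<in> carrier_mat k c"
  shows "mat_rank (B * C) \<le> k"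
proof -
  interpret vec_space "TYPE('a)" n .
  have sub: "set (cols (B * C)) \<subseteq> span (set (cols B))"
  proof
    fix v assume "v \<in> set (cols (B * C))"
    then obtain j where "j < c" "v = col (B * C) j"
      using B C by (auto simp: in_set_conv_nth)
    then have "v = B *\<^sub>v col C j" using col_mult2[OF B C] by simp
    moreover have "col C j \<in> carrier_vec (dim_col B)" using B C by auto
    ultimately have "v \<in> col_space B" using B unfolding col_space_eq[OF B] by auto
    then show "v \<in> span (set (cols B))" by (simp add: col_space_def)
  qed
  have cB: "set (cols B) \<subseteq> carrier_vec n" using B cols_dim by blast
  have BC: "B * C \<in> carrier_mat n c" using B C by simp
  have cBC: "set (cols (B * C)) \<subseteq> carrier_vec n" using BC cols_dim by blast
  have sB: "subspace class_ring (span (set (cols B))) V"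
    using cB span_is_subspace by blast
  have "subspace class_ring (span (set (cols (B * C)))) V"
    using cBC span_is_subspace by blast
  moreover have "span (set (cols (B * C))) \<subseteq> span (set (cols B))"
    using sub span_is_subset[OF sub] sB by (simp add: subspace_def)
  \<comment> \<open>The larger column space serves as the ambient space, in which dimension is
    monotone.\<close>
  ultimately have "subspace class_ring (span (set (cols (B * C)))) (span_vs (set (cols B)))"
    using nested_subspaces sB by blast
  then have "rank (B * C) \<le> rank B"
    unfolding rank_def
    using vectorspace.subspace_dim[OF subspace_is_vs[OF sB]] fin_dim_span_cols[OF B]
      fin_dim_span_cols[OF BC] by auto
  also have "\<dots> \<le> k" by (rule rank_le_nc[OF B])
  finally show ?thesis using B by (simp add: mat_rank_def)
qed

text \<open>A maximal independent set of columns of \<open>A\<close> forms \<open>B\<close>; the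
  coordinates of the columns of \<open>A\<close> with respect to it form \<open>C\<close>.\<close>

lemma mat_rank_factorization:
  assumes A: "A \<in> carrier_mat n c"
  obtains B C where "B \<in> carrier_mat n (mat_rank A)" "C \<in> carrier_mat (mat_rank A) c" "A = B * C"
proof -
  interpret vec_space "TYPE('a)" n .
  let ?P = "\<lambda>T. T \<subseteq> set (cols A) \<and> lin_indpt T"
  have cA: "set (cols A) \<subseteq> carrier_vec n" using A cols_dim by blast
  have "?P {}" using dim_zero_vs by (metis empty_subsetI fin_dim finite_basis_exists subset_li_is_li basis_def)
  then obtain S where fin: "finite S" and max: "maximal S ?P"
    using maximal_exists_superset[of "set (cols A)" ?P "{}"] by auto
  have S: "S \<subseteq> set (cols A)" and li: "lin_indpt S" using max by (auto simp: maximal_def)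
  have cS: "S \<subseteq> carrier_vec n" using S cA by blast
  obtain ss where ss: "set ss = S" "distinct ss" using finite_distinct_list[OF fin] by blast
  define B where "B = mat_of_cols n ss"
  have "mat_rank A = card S"
    using rank_card_indpt[OF A max] A by (simp add: mat_rank_def)
  then have r: "mat_rank A = length ss" using ss distinct_card by metis
  have B: "B \<in> carrier_mat n (mat_rank A)" by (simp add: B_def r)
  have cB: "set (cols B) = S" using ss cS by (simp add: B_def)
  \<comment> \<open>A column outside \<open>span S\<close> could be added to \<open>S\<close>
    without losing independence, against maximality.\<close>
  have mem: "s \<in> span S" if s: "s \<in> set (cols A)" for s
  proof (rule ccontr)
    assume ns: "s \<notin> span S"
    have "s \<notin> S" using ns cS span_mem by auto
    moreover have "lin_indpt (S \<union> {s})"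
      using ns lin_dep_iff_in_span[OF cS li _ \<open>s \<notin> S\<close>] s cA by auto
    then have "?P (S \<union> {s})" using S s by auto
    ultimately show False using max unfolding maximal_def by blast
  qed
  have "\<exists>x \<in> carrier_vec (mat_rank A). B *\<^sub>v x = col A j" if "j < c" for j
  proof -
    have "col A j \<in> span S" using that A by (intro mem) (auto simp: cols_def)
    then have "col A j \<in> col_space B" by (simp add: col_space_def cB)
    then show ?thesis using B unfolding col_space_eq[OF B] by auto
  qed
  then obtain x where x: "\<And>j. j < c \<Longrightarrow> x j \<in> carrier_vec (mat_rank A) \<and> B *\<^sub>v x j = col A j"
    by metis
  define C where "C = mat_of_cols (mat_rank A) (map x [0..<c])"
  have C: "C \<in> carrier_mat (mat_rank A) c" by (rule carrier_matI) (simp_all add: C_def)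
  have "A = B * C"
  proof (rule mat_col_eqI)
    show "dim_row A = dim_row (B * C)" "dim_col A = dim_col (B * C)" using A B C by auto
    fix j assume "j < dim_col (B * C)"
    then have j: "j < c" using C by simp
    have "col C j = x j" using x j by (simp add: C_def)
    then show "col A j = col (B * C) j" using col_mult2[OF B C j] x[OF j] by simp
  qed
  then show thesis using that B C by blast
qed

lemma mat_rank_le_dims:
  assumes "A \<in> carrier_mat n c"
  shows "mat_rank A \<le> n" "mat_rank A \<le> c"
  using mat_rank_mult_le[of "1\<^sub>m n" n n A c] mat_rank_mult_le[of A n c "1\<^sub>m c" c] assms by simp_all

lemma mat_rank_zero: "mat_rank (0\<^sub>m n c :: 'a::field mat) = 0"
  by (simp add: mat_rank_def vec_space.rank_0I)

lemma mat_rank_add_le: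
  assumes "A \<in> carrier_mat n c" "B \<in> carrier_mat n c"
  shows "mat_rank (A + B) \<le> mat_rank A + mat_rank B"
  using vec_space.rank_subadditive[OF assms] assms by (simp add: mat_rank_def)

lemma mat_rank_uminus_le:
  assumes A: "A \<in> carrier_mat n c"
  shows "mat_rank (- A) \<le> mat_rank A"
proof -
  obtain B C where BC: "B \<in> carrier_mat n (mat_rank A)" "C \<in> carrier_mat (mat_rank A) c" "A = B * C"
    using mat_rank_factorization[OF A] .
  then have "- A = (- B) * C" by simp
  then show ?thesis using mat_rank_mult_le[of "- B" n "mat_rank A" C c] BC by simp
qed

lemma mat_rank_minus_le:
  assumes "A \<in> carrier_mat n c" "B \<in> carrier_mat n c"
  shows "mat_rank (A - B) \<le> mat_rank A + mat_rank B"
proof -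
  have "A - B = A + (- B)" using assms by (intro eq_matI) auto
  then show ?thesis
    using mat_rank_add_le[of A n c "- B"] mat_rank_uminus_le[of B n c] assms by simp
qed

text \<open>Cut the inner dimension of a rank factorisation in two. With
  \<open>a = b = \<delta>\<close> this turns a matrix of rank at most \<open>2 * \<delta>\<close>
  into two admissible errors.\<close>

lemma mat_rank_split:
  fixes A :: "'a::field mat"
  assumes A: "A \<in> carrier_mat n c" and le: "mat_rank A \<le> a + b"
  obtains A1 A2 where "A1 \<in> carrier_mat n c" "A2 \<in> carrier_mat n c" "A = A1 + A2"
    "mat_rank A1 \<le> a" "mat_rank A2 \<le> b"
proof -
  define r where "r = mat_rank A"
  \<comment> \<open>The minimum covers a rank below \<open>a\<close>, where the second block is
    empty; otherwise \<open>r - a \<le> b\<close> columns remain.\<close>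
  define k where "k = min a r"
  obtain B C where BC: "B \<in> carrier_mat n r" "C \<in> carrier_mat r c" "A = B * C"
    using mat_rank_factorization[OF A] unfolding r_def .
  define B1 B2 where "B1 = mat n k (\<lambda>(i, j). B $$ (i, j))"
    and "B2 = mat n (r - k) (\<lambda>(i, j). B $$ (i, k + j))"
  define C1 C2 where "C1 = mat k c (\<lambda>(i, j). C $$ (i, j))"
    and "C2 = mat (r - k) c (\<lambda>(i, j). C $$ (k + i, j))"
  note defs = B1_def B2_def C1_def C2_def
  have k: "k \<le> r" "k \<le> a" "r - k \<le> b" using le by (auto simp: k_def r_def)
  have "A = B1 * C1 + B2 * C2"
  proof (rule eq_matI)
    show "dim_row A = dim_row (B1 * C1 + B2 * C2)" "dim_col A = dim_col (B1 * C1 + B2 * C2)"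
      using A by (auto simp: defs)
    fix i j assume "i < dim_row (B1 * C1 + B2 * C2)" "j < dim_col (B1 * C1 + B2 * C2)"
    then have ij: "i < n" "j < c" by (auto simp: defs)
    let ?f = "\<lambda>l. B $$ (i, l) * C $$ (l, j)"
    have "A $$ (i, j) = sum ?f {0..<r}"
      using ij BC by (auto simp: scalar_prod_def intro!: sum.cong)
    also have "\<dots> = sum ?f {0..<k} + sum ?f {k..<r}"
      using k by (simp add: sum.atLeastLessThan_concat)
    also have "sum ?f {k..<r} = (\<Sum>l = 0..<r - k. ?f (k + l))"
      using sum.shift_bounds_nat_ivl[of ?f 0 k "r - k"] k by (simp add: add.commute)
    finally show "A $$ (i, j) = (B1 * C1 + B2 * C2) $$ (i, j)"
      using ij by (simp add: defs scalar_prod_def)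
  qed
  moreover have "mat_rank (B1 * C1) \<le> a" "mat_rank (B2 * C2) \<le> b"
    using mat_rank_mult_le[of B1 n k C1 c] mat_rank_mult_le[of B2 n "r - k" C2 c] k
    by (auto simp: defs)
  moreover have "B1 * C1 \<in> carrier_mat n c" "B2 * C2 \<in> carrier_mat n c" by (auto simp: defs)
  ultimately show thesis using that by blast
qed

section \<open>Matrices supported on the first rows or columns\<close>

text \<open>Such a matrix is its top \<open>d\<close> rows, embedded by a truncated identity: a
  factorisation through dimension \<open>d\<close>.\<close>

lemma mat_rank_le_of_zero_rows:
  fixes A :: "'a::field mat"
  assumes A: "A \<in> carrier_mat n c"
    and zero: "\<And>i j. d \<le> i \<Longrightarrow> i < n \<Longrightarrow> j < c \<Longrightarrow> A $$ (i, j) = 0" and d: "d \<le> n"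
  shows "mat_rank A \<le> d"
proof -
  let ?B = "mat n d (\<lambda>(i, j). if i = j then 1 else 0) :: 'a mat"
  let ?C = "mat d c (\<lambda>(i, j). A $$ (i, j))"
  have "A = ?B * ?C"
    using A zero d by (intro eq_matI) (auto simp: scalar_prod_def if_distrib[of "\<lambda>z. z * _"] cong: if_cong)
  then show ?thesis using mat_rank_mult_le[of ?B n d ?C c] by simp
qed

lemma mat_rank_le_of_zero_cols:
  fixes A :: "'a::field mat"
  assumes A: "A \<in> carrier_mat n c"
    and zero: "\<And>i j. d \<le> j \<Longrightarrow> i < n \<Longrightarrow> j < c \<Longrightarrow> A $$ (i, j) = 0" and d: "d \<le> c"
  shows "mat_rank A \<le> d"
proof -
  let ?B = "mat n d (\<lambda>(i, j). A $$ (i, j))"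
  let ?C = "mat d c (\<lambda>(i, j). if i = j then 1 else 0) :: 'a mat"
  have "A = ?B * ?C"
    using A zero d by (intro eq_matI) (auto simp: scalar_prod_def if_distrib cong: if_cong)
  then show ?thesis using mat_rank_mult_le[of ?B n d ?C c] by simp
qed

section \<open>The Singleton bound for rank metric codes\<close>

text \<open>A matrix is determined by its entries on the index rectangle, so the extensional
  functions there map onto the carrier.\<close>

lemma
  shows finite_carrier_mat: "finite (carrier_mat r c :: 'a::finite mat set)"
    and card_carrier_mat_le: "card (carrier_mat r c :: 'a mat set) \<le> CARD('a) ^ (r * c)"
proof -
  let ?F = "({..<r} \<times> {..<c}) \<rightarrow>\<^sub>E (UNIV :: 'a set)"
  have sub: "carrier_mat r c \<subseteq> mat r c ` ?F"
  proof
    fix A :: "'a mat" assume A: "A \<in> carrier_mat r c"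
    have "A = mat r c (restrict (($$) A) ({..<r} \<times> {..<c}))"
      using A by (intro eq_matI) auto
    moreover have "restrict (($$) A) ({..<r} \<times> {..<c}) \<in> ?F" by auto
    ultimately show "A \<in> mat r c ` ?F" by blast
  qed
  have fin: "finite ?F" by (intro finite_PiE) auto
  show "finite (carrier_mat r c :: 'a mat set)" using sub fin finite_surj by blast
  have "card (carrier_mat r c :: 'a mat set) \<le> card ?F"
    using sub fin surj_card_le by blast
  also have "\<dots> = CARD('a) ^ (r * c)" by (simp add: card_PiE card_cartesian_product)
  finally show "card (carrier_mat r c :: 'a mat set) \<le> CARD('a) ^ (r * c)" .
qed

text \<open>Two codewords that agree after deletion of the first \<open>d\<close> rows, or columns,
  differ by a matrix of rank at most \<open>d\<close>, so they coincide; the code thus embeds into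
  the smaller matrix space.\<close>

lemma rank_singleton_bound:
  fixes C :: "'a::{field,finite} mat set"
  assumes C: "C \<subseteq> carrier_mat N t"
    and dist: "\<And>A B. A \<in> C \<Longrightarrow> B \<in> C \<Longrightarrow> A \<noteq> B \<Longrightarrow> d < mat_rank (A - B)"
    and d: "d \<le> N" "d \<le> t"
  shows "card C \<le> CARD('a) ^ ((N - d) * t)" "card C \<le> CARD('a) ^ (N * (t - d))"
proof -
  let ?rows = "\<lambda>A :: 'a mat. mat (N - d) t (\<lambda>(i, j). A $$ (i + d, j))"
  have "inj_on ?rows C"
  proof (rule inj_onI, rule ccontr)
    fix A B assume AB: "A \<in> C" "B \<in> C" "?rows A = ?rows B" "A \<noteq> B"
    have c: "A \<in> carrier_mat N t" "B \<in> carrier_mat N t" using AB C by auto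
    have "A $$ (i, j) = B $$ (i, j)" if "d \<le> i" "i < N" "j < t" for i j
      using arg_cong[OF AB(3), of "\<lambda>A. A $$ (i - d, j)"] that by simp
    then have "mat_rank (A - B) \<le> d"
      using c d by (intro mat_rank_le_of_zero_rows[of _ N t]) auto
    then show False using dist AB by force
  qed
  then have "card C \<le> card (carrier_mat (N - d) t :: 'a mat set)"
    by (rule card_inj_on_le) (auto simp: finite_carrier_mat)
  then show "card C \<le> CARD('a) ^ ((N - d) * t)" using card_carrier_mat_le order_trans by blast
  let ?cols = "\<lambda>A :: 'a mat. mat N (t - d) (\<lambda>(i, j). A $$ (i, j + d))"
  have "inj_on ?cols C"
  proof (rule inj_onI, rule ccontr)
    fix A B assume AB: "A \<in> C" "B \<in> C" "?cols A = ?cols B" "A \<noteq> B"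
    have c: "A \<in> carrier_mat N t" "B \<in> carrier_mat N t" using AB C by auto
    have "A $$ (i, j) = B $$ (i, j)" if "d \<le> j" "i < N" "j < t" for i j
      using arg_cong[OF AB(3), of "\<lambda>A. A $$ (i, j - d)"] that by simp
    then have "mat_rank (A - B) \<le> d"
      using c d by (intro mat_rank_le_of_zero_cols[of _ N t]) auto
    then show False using dist AB by force
  qed
  then have "card C \<le> card (carrier_mat N (t - d) :: 'a mat set)"
    by (rule card_inj_on_le) (auto simp: finite_carrier_mat)
  then show "card C \<le> CARD('a) ^ (N * (t - d))" using card_carrier_mat_le order_trans by blast
qed

section \<open>Error-correcting index codes\<close>

text \<open>Rearranges a split difference into two equal received words, with errors
  \<open>- S\<close> and \<open>T\<close>.\<close>

lemma add_uminus_eq_add: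
  fixes P :: "'a::ab_group_add mat"
  assumes c: "P \<in> carrier_mat n c" "Q \<in> carrier_mat n c" "S \<in> carrier_mat n c" "T \<in> carrier_mat n c"
    and eq: "P - Q = S + T"
  shows "P + - S = Q + T"
proof (rule eq_matI)
  show "dim_row (P + - S) = dim_row (Q + T)" "dim_col (P + - S) = dim_col (Q + T)" using c by auto
  fix i j assume "i < dim_row (Q + T)" "j < dim_col (Q + T)"
  then have ij: "i < n" "j < c" using c by auto
  have "P $$ (i, j) - Q $$ (i, j) = S $$ (i, j) + T $$ (i, j)"
    using arg_cong[OF eq, of "\<lambda>A. A $$ (i, j)"] ij c by simp
  then show "(P + - S) $$ (i, j) = (Q + T) $$ (i, j)"
    using ij c by (simp add: algebra_simps)
qed

text \<open>An image of rank at most \<open>2 * \<delta>\<close> splits as \<open>W1 + W2\<close>.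
  Then \<open>A\<close> sent with error \<open>- W1\<close> and \<open>B\<close> sent with error
  \<open>W2\<close> give receiver \<open>i\<close> the same word and the same side information,
  although the demanded rows differ.\<close>

lemma represents_ECIC_rank_gt:
  assumes rep: "represents_ECIC t m R VS V M \<delta> N L"
    and VS: "VS \<in> carrier_mat k n" and Vi: "V i \<in> carrier_mat l n"
    and R: "R \<in> carrier_mat m n" and i: "i < m"
    and AB: "A \<in> M" "B \<in> M" "A \<in> carrier_mat n t" "B \<in> carrier_mat n t"
    and Z: "A - B \<in> Z_set t n R \<delta> V i"
  shows "2 * \<delta> < mat_rank (L * VS * (A - B))"
proof (rule ccontr)
  assume "\<not> ?thesis"
  then have le: "mat_rank (L * VS * (A - B)) \<le> \<delta> + \<delta>" by simp
  have L: "L \<in> carrier_mat N k" using rep VS by (auto simp: represents_ECIC_def)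
  have LVS: "L * VS \<in> carrier_mat N n" using L VS by simp
  have "L * VS * (A - B) \<in> carrier_mat N t" using LVS AB by (meson minus_carrier_mat mult_carrier_mat)
  then obtain W1 W2 where W: "W1 \<in> carrier_mat N t" "W2 \<in> carrier_mat N t"
      "L * VS * (A - B) = W1 + W2" "mat_rank W1 \<le> \<delta>" "mat_rank W2 \<le> \<delta>"
    using mat_rank_split[OF _ le] by metis
  from rep i obtain D where D: "\<And>Y W. Y \<in> M \<Longrightarrow> W \<in> carrier_mat N t \<Longrightarrow> mat_rank W \<le> \<delta> \<Longrightarrow>
      D (L * VS * Y + W) (V i * Y) = row (R * Y) i"
    unfolding represents_ECIC_def by metis
  have uW: "mat_rank (- W1) \<le> \<delta>" "- W1 \<in> carrier_mat N t"
    using mat_rank_uminus_le[OF W(1)] W by auto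
  have "L * VS * A - L * VS * B = W1 + W2"
    using W(3) mult_minus_distrib_mat[OF LVS AB(3,4)] by simp
  then have LVSW: "L * VS * A + - W1 = L * VS * B + W2"
    using W LVS AB by (intro add_uminus_eq_add) auto
  have "V i * A - V i * B = 0\<^sub>m l t"
    using Z mult_minus_distrib_mat[OF Vi AB(3,4)] Vi by (auto simp: Z_set_def)
  \<comment> \<open>The same rearrangement with both errors zero yields equal side
    information.\<close>
  then have "V i * A + - 0\<^sub>m l t = V i * B + 0\<^sub>m l t"
    using Vi AB by (intro add_uminus_eq_add) auto
  moreover have "- 0\<^sub>m l t = (0\<^sub>m l t :: 'a mat)" by (intro eq_matI) auto
  ultimately have "V i * A = V i * B" using Vi AB by simp
  with LVSW have "row (R * A) i = row (R * B) i"
    using D[OF AB(1) uW(2,1)] D[OF AB(2) W(2,5)] by simp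
  moreover have "R * (A - B) = R * A - R * B" using mult_minus_distrib_mat[OF R AB(3,4)] .
  then have "row (R * (A - B)) i = row (R * A) i - row (R * B) i"
    using i R AB by (intro eq_vecI) auto
  ultimately show False using Z R AB i by (auto simp: Z_set_def)
qed

section \<open>Existence of a code\<close>

text \<open>Row \<open>i\<close> of \<open>R\<close> is a combination \<open>y\<close> of the rows
  of \<open>VS\<close>, so its product with \<open>Y\<close> depends on \<open>Y\<close> only
  through \<open>VS * Y\<close>.\<close>

lemma row_mult_cong_row_span:
  assumes VS: "VS \<in> carrier_mat k n" and R: "R \<in> carrier_mat m n" "i < m"
    and mem: "row R i \<in> row_span VS"
    and Y: "Y \<in> carrier_mat n t" "Y' \<in> carrier_mat n t" and eq: "VS * Y = VS * Y'"
  shows "row (R * Y) i = row (R * Y') i"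
proof -
  have "vec_space.row_space n VS = row_span VS" using VS by (simp add: row_span_def)
  then obtain y where y: "y \<in> carrier_vec k" "VS\<^sup>T *\<^sub>v y = row R i"
    using mem vec_space.row_space_eq[OF VS] VS by auto
  have "row (R * Z) i = (VS * Z)\<^sup>T *\<^sub>v y" if Z: "Z \<in> carrier_mat n t" for Z
  proof -
    have "row (R * Z) i = Z\<^sup>T *\<^sub>v row R i"
      using R Z by (intro eq_vecI) (auto intro!: comm_scalar_prod[of _ n])
    also have "\<dots> = (Z\<^sup>T * VS\<^sup>T) *\<^sub>v y"
      using y Z VS by (simp flip: y(2))
    also have "Z\<^sup>T * VS\<^sup>T = (VS * Z)\<^sup>T" using transpose_mult[OF VS Z] by simp
    finally show ?thesis .
  qed
  then show ?thesis using Y eq by simp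
qed

text \<open>
  The identity matrix represents a code, so the \<open>LEAST\<close> in \<open>optimal_length\<close> ranges over a nonempty set.
\<close>

lemma represents_ECIC_identity:
  fixes VS :: "'a::{field,finite} mat"
  assumes VS: "VS \<in> carrier_mat k n" and R: "R \<in> carrier_mat m n"
    and mem: "\<And>i. i < m \<Longrightarrow> row R i \<in> row_span VS"
    and M: "message_space t n \<delta> VS M"
  shows "represents_ECIC t m R VS V M \<delta> k (1\<^sub>m k)"
proof -
  have Mc: "M \<subseteq> carrier_mat n t" using M by (simp add: message_space_def)
  have dist: "2 * \<delta> < mat_rank (VS * A - VS * B)" if "A \<in> M" "B \<in> M" "VS * A \<noteq> VS * B" for A B
    proof -
    have "\<forall>P \<in> (*) VS ` M. \<forall>Q \<in> (*) VS ` M. P \<noteq> Q \<longrightarrow> 2 * \<delta> + 1 \<le> mat_rank (P - Q)"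
      using M unfolding message_space_def has_min_rank_dist_def by blast
    then have "2 * \<delta> + 1 \<le> mat_rank (VS * A - VS * B)" using that by blast
    then show ?thesis by simp
  qed
  obtain A B where AB: "A \<in> M" "B \<in> M" "VS * A \<noteq> VS * B"
    using M by (auto simp: message_space_def has_min_rank_dist_def)
  then have "VS * A - VS * B \<in> carrier_mat k t" using Mc VS by (meson minus_carrier_mat mult_carrier_mat subsetD)
  \<comment> \<open>A code needs positive length: the nonzero distance between two encoded messages
    is a rank, bounded by \<open>k\<close>.\<close>
  then have "0 < k" using dist[OF AB] mat_rank_le_dims(1) by (metis gr_zeroI le_0_eq less_zeroE)
  \<comment> \<open>Bounded distance decoding: choose any message whose encoding is within \<delta>
    of the received word.\<close>
  define D where "D i W Z = row (R * (SOME Y. Y \<in> M \<and> mat_rank (W - VS * Y) \<le> \<delta>)) i"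
    for i and W Z :: "'a mat"
  have "D i (1\<^sub>m k * VS * Y + W) (V i * Y) = row (R * Y) i"
    if i: "i < m" and Y: "Y \<in> M" and W: "W \<in> carrier_mat k t" "mat_rank W \<le> \<delta>" for i Y W
  proof -
    let ?P = "\<lambda>Y'. Y' \<in> M \<and> mat_rank (1\<^sub>m k * VS * Y + W - VS * Y') \<le> \<delta>"
    have 1: "1\<^sub>m k * VS = VS" using VS by simp
    have c: "VS * A \<in> carrier_mat k t" if "A \<in> M" for A using that Mc VS by auto
    have "P + W - P = W" if "P \<in> carrier_mat k t" for P :: "'a mat"
      using that W by (intro eq_matI) auto
    then have "VS * Y + W - VS * Y = W" using c[OF Y] by blast
    then have "?P Y" using Y W 1 by simp
    \<comment> \<open>The message sent is itself a candidate, so the choice yields a valid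
      one.\<close>
    then have P: "?P (SOME Y'. ?P Y')" by (rule someI[where P = ?P])
    define Y' where "Y' = (SOME Y'. ?P Y')"
    have Y': "Y' \<in> M" "mat_rank (VS * Y + W - VS * Y') \<le> \<delta>" using P 1 by (simp_all add: Y'_def)
    \<comment> \<open>Triangle inequality through the received word: the two encodings are at
      distance at most \<open>2 * \<delta>\<close>, below the minimum distance, hence equal.\<close>
    have "P - Q = (P + W - Q) - W" if "P \<in> carrier_mat k t" "Q \<in> carrier_mat k t" for P Q :: "'a mat"
      using that W by (intro eq_matI) auto
    then have "VS * Y - VS * Y' = (VS * Y + W - VS * Y') - W" using c[OF Y] c[OF Y'(1)] by blast
    also have "mat_rank \<dots> \<le> \<delta> + \<delta>"
      using mat_rank_minus_le[of "VS * Y + W - VS * Y'" k t W] c[OF Y'(1)] W Y'(2)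
      by (simp add: minus_carrier_mat)
    finally have "VS * Y = VS * Y'" using dist[OF Y Y'(1)] by force
    then have "row (R * Y) i = row (R * Y') i"
      using row_mult_cong_row_span[OF VS R i mem[OF i]] Mc Y Y'(1) by blast
    then show ?thesis by (simp add: D_def Y'_def)
  qed
  then show ?thesis using \<open>0 < k\<close> VS unfolding represents_ECIC_def by auto
qed

section \<open>The extremal set and the bound\<close>

text \<open>There are finitely many sets of matrices, and \<open>{0\<^sub>m n t}\<close> qualifies
  vacuously, so \<open>Max\<close> is taken over a finite nonempty set.\<close>

lemma alpha_attained:
  fixes R :: "'a::{field,finite} mat"
  obtains U where "U \<in> J_sets t m n R V M \<delta>" "U \<noteq> {}"
    "alpha t m n R V M \<delta> = log (real CARD('a)) (real (card U))"
proof -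
  let ?f = "\<lambda>U :: 'a mat set. log (real CARD('a)) (real (card U))"
  let ?S = "{?f U | U. U \<in> J_sets t m n R V M \<delta> \<and> U \<noteq> {}}"
  have "?S \<subseteq> ?f ` Pow (carrier_mat n t)" by (auto simp: J_sets_def)
  then have "finite ?S" by (rule finite_subset) (simp add: finite_carrier_mat)
  moreover have "{0\<^sub>m n t} \<in> J_sets t m n R V M \<delta>" by (auto simp: J_sets_def)
  then have "?S \<noteq> {}" by blast
  ultimately have "Max ?S \<in> ?S" by (rule Max_in)
  then show thesis using that unfolding alpha_def by auto
qed

theorem mainTheorem12:
  fixes t m n \<delta> :: nat
    and XS :: "'a::{field,finite} vec set" and X :: "nat \<Rightarrow> 'a vec set"
    and R VS :: "'a mat" and V :: "nat \<Rightarrow> 'a mat" and M :: "'a mat set"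
  assumes inst: "iccsi_instance t m n XS X R"
    and VS: "spanning_matrix n XS VS"
    and V: "\<And>i. i < m \<Longrightarrow> spanning_matrix n (X i) (V i)"
    and M: "message_space t n \<delta> VS M"
    and pos: "alpha t m n R V M \<delta> > 0"
  shows "(t \<ge> shortest_code TYPE('a) t (alpha t m n R V M \<delta>) (2 * \<delta> + 1) \<longrightarrow>
            real (optimal_length t m R VS V M \<delta>) \<ge> alpha t m n R V M \<delta> / real t + 2 * real \<delta>) \<and>
         (t \<le> shortest_code TYPE('a) t (alpha t m n R V M \<delta>) (2 * \<delta> + 1) \<longrightarrow>
            real (optimal_length t m R VS V M \<delta>) \<ge> alpha t m n R V M \<delta> / (real t - 2 * real \<delta>))"
proof -
  have t: "1 < t" and R: "R \<in> carrier_mat m n" and RX: "\<And>i. i < m \<Longrightarrow> row R i \<in> XS"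
    using inst by (auto simp: iccsi_instance_def)
  define k where "k = subspace_dim n XS"
  have VSc: "VS \<in> carrier_mat k n" and VSX: "row_span VS = XS"
    using VS by (auto simp: spanning_matrix_def k_def)
  have Mc: "M \<subseteq> carrier_mat n t" using M by (simp add: message_space_def)
  define N where "N = optimal_length t m R VS V M \<delta>"
  have "\<exists>L. represents_ECIC t m R VS V M \<delta> k L"
    using represents_ECIC_identity[OF VSc R _ M] RX VSX by blast
  then have "\<exists>L. represents_ECIC t m R VS V M \<delta> N L"
    unfolding N_def optimal_length_def by (rule LeastI)
  then obtain L where rep: "represents_ECIC t m R VS V M \<delta> N L" ..
  have LVS: "L * VS \<in> carrier_mat N n" using rep VSc by (auto simp: represents_ECIC_def)
  obtain U where U: "U \<in> J_sets t m n R V M \<delta>"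
    and aU: "alpha t m n R V M \<delta> = log (real CARD('a)) (real (card U))"
    by (rule alpha_attained)
  have Uc: "U \<subseteq> carrier_mat n t" using U by (simp add: J_sets_def)
  \<comment> \<open>Elements of \<open>U\<close> need not be messages, but their differences are
    differences of messages; linearity of the encoding carries the rank estimate over.\<close>
  have far: "2 * \<delta> < mat_rank (L * VS * Y - L * VS * Y')" if Y: "Y \<in> U" "Y' \<in> U" "Y \<noteq> Y'" for Y Y'
  proof -
    obtain i A B where i: "i < m" "Y - Y' \<in> Z_set t n R \<delta> V i"
      and AB: "A \<in> M" "B \<in> M" "Y - Y' = A - B"
      using U Y unfolding J_sets_def by blast
    have "V i \<in> carrier_mat (subspace_dim n (X i)) n"
      using V[OF i(1)] by (simp add: spanning_matrix_def)
    then have "2 * \<delta> < mat_rank (L * VS * (A - B))"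
      using represents_ECIC_rank_gt[OF rep VSc _ R i(1)] AB Mc i(2) by auto
    also have "L * VS * (A - B) = L * VS * Y - L * VS * Y'"
      using mult_minus_distrib_mat[OF LVS, of Y t Y'] Y Uc AB(3) by auto
    finally show ?thesis .
  qed
  define C where "C = (\<lambda>Y. L * VS * Y) ` U"
  have Cc: "C \<subseteq> carrier_mat N t" using LVS Uc by (auto simp: C_def)
  have "inj_on (\<lambda>Y. L * VS * Y) U"
  proof (rule inj_onI, rule ccontr)
    fix Y Y' assume Y: "Y \<in> U" "Y' \<in> U" "L * VS * Y = L * VS * Y'" "Y \<noteq> Y'"
    then have "L * VS * Y - L * VS * Y' = 0\<^sub>m N t"
      using LVS Uc by (metis minus_r_inv_mat mult_carrier_mat subsetD)
    then show False using far[OF Y(1,2,4)] by (simp add: mat_rank_zero)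
  qed
  then have card: "card C = card U" by (simp add: C_def card_image)
  \<comment> \<open>Positivity of \<alpha> rules out both cases, since \<open>ln 0 = 0\<close> by
    convention and \<open>ln 1 = 0\<close>.\<close>
  have "\<not> card U \<le> 1"
  proof
    assume "card U \<le> 1"
    then have "card U = 0 \<or> card U = 1" by linarith
    then show False using pos aU by (auto simp: log_def)
  qed
  then obtain Y Y' where "Y \<in> U" "Y' \<in> U" "Y \<noteq> Y'"
    by (metis One_nat_def card_le_Suc0_iff_eq card.infinite le0)
  then have "2 * \<delta> < mat_rank (L * VS * Y - L * VS * Y')"
    "L * VS * Y - L * VS * Y' \<in> carrier_mat N t"
    using far Cc by (auto simp: C_def minus_carrier_mat)
  \<comment> \<open>A rank above \<open>2 * \<delta>\<close> must fit into an \<open>N\<close> by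
    \<open>t\<close> matrix. Hence the natural-number subtractions below do not truncate, and the
    divisor \<open>t - 2 * \<delta>\<close> is positive.\<close>
  then have d: "2 * \<delta> < N" "2 * \<delta> < t" using mat_rank_le_dims by (meson order_less_le_trans)+
  have q: "1 < real CARD('a)" using card_mono[of UNIV "{0, 1 :: 'a}"] by simp
  have cardle: "card U \<le> CARD('a) ^ ((N - 2 * \<delta>) * t)" "card U \<le> CARD('a) ^ (N * (t - 2 * \<delta>))"
    using rank_singleton_bound[OF Cc, of "2 * \<delta>"] far d by (auto simp: C_def card[unfolded C_def])
  have log: "alpha t m n R V M \<delta> \<le> real e" if "card U \<le> CARD('a) ^ e" for e
  proof -
    have "real (card U) \<le> real CARD('a) ^ e" using that by (metis of_nat_le_iff of_nat_power)
    then show ?thesis using aU q \<open>\<not> card U \<le> 1\<close> by (simp add: log_of_power_le)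
  qed
  \<comment> \<open>Logarithms to base \<open>CARD('a)\<close>: row deletion gives this bound,
    column deletion the next one.\<close>
  have "alpha t m n R V M \<delta> \<le> (real N - 2 * real \<delta>) * real t"
    using log[OF cardle(1)] d by (simp add: of_nat_diff)
  then have "alpha t m n R V M \<delta> / real t + 2 * real \<delta> \<le> real N"
    using t by (simp add: field_simps)
  moreover have "alpha t m n R V M \<delta> \<le> real N * (real t - 2 * real \<delta>)"
    using log[OF cardle(2)] d by (simp add: of_nat_diff)
  moreover have "0 < real t - 2 * real \<delta>" using d by linarith
  ultimately show ?thesis unfolding N_def[symmetric] by (simp add: pos_divide_le_eq)
qed

end
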